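(* Let $(\mathfrak{g} = \bigoplus_{n \geq 0} \mathfrak{g}^n, [~,~])$ be a non-negatively graded Lie algebra over a field $\mathbb{K}$ of characteristic $0$. Define $(\mathfrak{g}_c)^0 = \mathfrak{g}^0$, $(\mathfrak{g}_c)^n = \underbrace{\mathfrak{g}^n \oplus \cdots \oplus \mathfrak{g}^n}_{(n+1)\text{ times}}$ for $n \geq 1$, $\mathfrak{g}_c = \bigoplus_{n\geq 0} (\mathfrak{g}_c)^n$, and define a degree $0$ bracket $[\![~,~]\!] : (\mathfrak{g}_c)^m \times (\mathfrak{g}_c)^n \to (\mathfrak{g}_c)^{m+n}$ for $m,n\ge 0$ by letting $[\![(f_1,\ldots,f_{m+1}),(g_1,\ldots,g_{n+1})]\!]$ be the $(m+n+1)$-tuple whose $i$-th entry ($1 \leq i \leq m+n+1$) is $$\sum_{\substack{q+r=i+1\\ 1\le q\le m+1,\ 1\le r\le n+1}} [f_q, g_r].$$ Then: (i) $(\mathfrak{g}_c, [\![~,~]\!])$ is a graded Lie algebra. Moreover, the map $\phi : \mathfrak{g}_c \to \mathfrak{g}$ defined by $\phi(f) = f$ for $f \in (\mathfrak{g}_c)^0 = \mathfrak{g}^0$ and $\phi((f_1,\ldots,f_{n+1})) = f_1 + \cdots + f_{n+1}$ for $(f_1,\ldots,f_{n+1}) \in (\mathfrak{g}_c)^n$ is a morphism of graded Lie algebras. (ii) A pair $(\theta_1,\theta_2)$ of elements of $\mathfrak{g}^1$ is a compatible pair of Maurer-Cartan elements of $\mathfrak{g}$ if and only if $(\theta_1,\theta_2)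 \in (\mathfrak{g}_c)^1 = \mathfrak{g}^1\oplus\mathfrak{g}^1$ is a Maurer-Cartan element of the graded Lie algebra $(\mathfrak{g}_c, [\![~,~]\!])$.
   Context: All vector spaces are over a field $\mathbb{K}$ of characteristic $0$ (the paper assumes throughout that vector spaces are finite-dimensional). A graded Lie algebra is a graded vector space $\mathfrak{g}=\bigoplus_n\mathfrak{g}^n$ with a degree $0$ bilinear bracket satisfying graded skew-symmetry $[x,y] = -(-1)^{mn}[y,x]$ and the graded Jacobi identity $[x,[y,z]] = [[x,y],z] + (-1)^{mn}[y,[x,z]]$ for $x\in\mathfrak{g}^m$, $y\in\mathfrak{g}^n$. A Maurer-Cartan element of a graded Lie algebra $(\mathfrak{g},[~,~])$ is an element $\theta\in\mathfrak{g}^1$ with $[\theta,\theta]=0$. Two Maurer-Cartan elements $\theta_1,\theta_2$ are compatible if in addition $[\theta_1,\theta_2]=0$; then $(\theta_1,\theta_2)$ is called a compatible pair of Maurer-Cartan elements of $\mathfrak{g}$. *)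

theory Defs
  imports Complex_Main "HOL-Library.Function_Algebras"
begin

text \<open>
  A graded vector space is the internal direct sum of subspaces \<open>V n\<close> of some ambient space.
  The ambient type may be larger than the sum; the underlying space is \<open>graded_total scale V\<close>,
  and nothing is required of a map outside it.
\<close>

definition graded_total :: "('k::field \<Rightarrow> 'v::ab_group_add \<Rightarrow> 'v) \<Rightarrow> (nat \<Rightarrow> 'v set) \<Rightarrow> 'v set" where
  "graded_total scale V = module.span scale (\<Union>n. V n)"

locale graded_vector_space = vector_space scale
  for scale :: "'k::field_char_0 \<Rightarrow> 'v::ab_group_add \<Rightarrow> 'v" +
  fixes V :: "nat \<Rightarrow> 'v set"
  assumes subspace_component: "subspace (V n)"
    and direct_sum: "finite N \<Longrightarrow> (\<And>n. n \<in> N \<Longrightarrow> x n \<in> V n) \<Longrightarrow> (\<Sum>n\<in>N. x n) = 0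
      \<Longrightarrow> n \<in> N \<Longrightarrow> x n = 0"

locale graded_Lie_algebra = graded_vector_space scale V
  for scale :: "'k::field_char_0 \<Rightarrow> 'v::ab_group_add \<Rightarrow> 'v" and V :: "nat \<Rightarrow> 'v set" +
  fixes br :: "'v \<Rightarrow> 'v \<Rightarrow> 'v"
  assumes br_add_left: "\<lbrakk>x \<in> graded_total scale V; y \<in> graded_total scale V; z \<in> graded_total scale V\<rbrakk>
      \<Longrightarrow> br (x + y) z = br x z + br y z"
    and br_add_right: "\<lbrakk>x \<in> graded_total scale V; y \<in> graded_total scale V; z \<in> graded_total scale V\<rbrakk>
      \<Longrightarrow> br x (y + z) = br x y + br x z"
    and br_scale_left: "\<lbrakk>x \<in> graded_total scale V; y \<in> graded_total scale V\<rbrakk>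
      \<Longrightarrow> br (scale c x) y = scale c (br x y)"
    and br_scale_right: "\<lbrakk>x \<in> graded_total scale V; y \<in> graded_total scale V\<rbrakk>
      \<Longrightarrow> br x (scale c y) = scale c (br x y)"
    and br_degree: "\<lbrakk>x \<in> V m; y \<in> V n\<rbrakk> \<Longrightarrow> br x y \<in> V (m + n)"
    and br_skew: "\<lbrakk>x \<in> V m; y \<in> V n\<rbrakk> \<Longrightarrow> br x y = - scale ((- 1) ^ (m * n)) (br y x)"
    and br_Jacobi: "\<lbrakk>x \<in> V m; y \<in> V n; z \<in> V p\<rbrakk>
      \<Longrightarrow> br x (br y z) = br (br x y) z + scale ((- 1) ^ (m * n)) (br y (br x z))"

locale graded_Lie_morphism =
  dom: graded_Lie_algebra scale\<^sub>1 V\<^sub>1 br\<^sub>1 + cod: graded_Lie_algebra scale\<^sub>2 V\<^sub>2 br\<^sub>2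
  for scale\<^sub>1 :: "'k::field_char_0 \<Rightarrow> 'v::ab_group_add \<Rightarrow> 'v" and V\<^sub>1 br\<^sub>1
    and scale\<^sub>2 :: "'k \<Rightarrow> 'w::ab_group_add \<Rightarrow> 'w" and V\<^sub>2 br\<^sub>2 +
  fixes f :: "'v \<Rightarrow> 'w"
  assumes map_add: "\<lbrakk>x \<in> graded_total scale\<^sub>1 V\<^sub>1; y \<in> graded_total scale\<^sub>1 V\<^sub>1\<rbrakk> \<Longrightarrow> f (x + y) = f x + f y"
    and map_scale: "x \<in> graded_total scale\<^sub>1 V\<^sub>1 \<Longrightarrow> f (scale\<^sub>1 c x) = scale\<^sub>2 c (f x)"
    and map_degree: "x \<in> V\<^sub>1 n \<Longrightarrow> f x \<in> V\<^sub>2 n"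
    and map_br: "\<lbrakk>x \<in> graded_total scale\<^sub>1 V\<^sub>1; y \<in> graded_total scale\<^sub>1 V\<^sub>1\<rbrakk>
      \<Longrightarrow> f (br\<^sub>1 x y) = br\<^sub>2 (f x) (f y)"

definition Maurer_Cartan :: "(nat \<Rightarrow> 'v set) \<Rightarrow> ('v \<Rightarrow> 'v \<Rightarrow> 'v::zero) \<Rightarrow> 'v \<Rightarrow> bool" where
  "Maurer_Cartan V br \<theta> \<longleftrightarrow> \<theta> \<in> V 1 \<and> br \<theta> \<theta> = 0"

definition compatible_MC_pair :: "(nat \<Rightarrow> 'v set) \<Rightarrow> ('v \<Rightarrow> 'v \<Rightarrow> 'v::zero) \<Rightarrow> 'v \<Rightarrow> 'v \<Rightarrow> bool" where
  "compatible_MC_pair V br \<theta>\<^sub>1 \<theta>\<^sub>2 \<longleftrightarrow>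
     Maurer_Cartan V br \<theta>\<^sub>1 \<and> Maurer_Cartan V br \<theta>\<^sub>2 \<and> br \<theta>\<^sub>1 \<theta>\<^sub>2 = 0"

text \<open>
  Elements of \<open>\<gg>\<^sub>c\<close> are families \<open>F :: nat \<Rightarrow> nat \<Rightarrow> 'v\<close>, where \<open>F n i\<close> is the
  \<open>i\<close>-th entry (\<open>1 \<le> i \<le> n + 1\<close>) of the tuple that is the degree \<open>n\<close> component of \<open>F\<close>;
  all other values are \<open>0\<close>. Addition is pointwise. The homogeneous element given by a
  tuple, written as a nonempty list, has as degree the length minus one.
\<close>

definition gc_tuple :: "'v list \<Rightarrow> nat \<Rightarrow> nat \<Rightarrow> 'v::zero" where
  "gc_tuple xs = (\<lambda>n i. if length xs = n + 1 \<and> 1 \<le> i \<and> i \<le> n + 1 then xs ! (i - 1) else 0)"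

definition gc_component :: "(nat \<Rightarrow> 'v set) \<Rightarrow> nat \<Rightarrow> (nat \<Rightarrow> nat \<Rightarrow> 'v::zero) set" where
  "gc_component V n = {gc_tuple xs | xs. length xs = n + 1 \<and> set xs \<subseteq> V n}"

definition gc_scale :: "('k \<Rightarrow> 'v \<Rightarrow> 'v) \<Rightarrow> 'k \<Rightarrow> (nat \<Rightarrow> nat \<Rightarrow> 'v) \<Rightarrow> nat \<Rightarrow> nat \<Rightarrow> 'v" where
  "gc_scale scale c F = (\<lambda>n i. scale c (F n i))"

text \<open>
  The \<open>i\<close>-th entry of the bracket of an \<open>(m + 1)\<close>-tuple and an \<open>(n + 1)\<close>-tuple. The index
  set is empty unless \<open>1 \<le> i \<le> m + n + 1\<close>.
\<close>

definition tuple_bracket ::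
  "('v \<Rightarrow> 'v \<Rightarrow> 'v) \<Rightarrow> nat \<Rightarrow> nat \<Rightarrow> (nat \<Rightarrow> 'v) \<Rightarrow> (nat \<Rightarrow> 'v) \<Rightarrow> nat \<Rightarrow> 'v::comm_monoid_add" where
  "tuple_bracket br m n f g i =
     (\<Sum>(q, r) \<in> {(q, r). q + r = i + 1 \<and> 1 \<le> q \<and> q \<le> m + 1 \<and> 1 \<le> r \<and> r \<le> n + 1}. br (f q) (g r))"

text \<open>The bracket on all of \<open>\<gg>\<^sub>c\<close> is the biadditive extension from homogeneous elements.\<close>

definition gc_bracket ::
  "('v \<Rightarrow> 'v \<Rightarrow> 'v) \<Rightarrow> (nat \<Rightarrow> nat \<Rightarrow> 'v) \<Rightarrow> (nat \<Rightarrow> nat \<Rightarrow> 'v) \<Rightarrow> nat \<Rightarrow> nat \<Rightarrow> 'v::comm_monoid_add" where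
  "gc_bracket br F G = (\<lambda>k i. \<Sum>(m, n) \<in> {(m, n). m + n = k}. tuple_bracket br m n (F m) (G n) i)"

definition gc_phi :: "(nat \<Rightarrow> nat \<Rightarrow> 'v) \<Rightarrow> 'v::comm_monoid_add" where
  "gc_phi F = (\<Sum>n \<in> {n. F n \<noteq> 0}. \<Sum>i = 1..n + 1. F n i)"

text \<open>On homogeneous elements the definitions above reduce to the expected tuple formulas.\<close>

lemma (in graded_Lie_algebra) gc_bracket_tuple:
  assumes xs: "length xs = m + 1" "set xs \<subseteq> V m" and ys: "length ys = n + 1" "set ys \<subseteq> V n"
  shows "gc_bracket br (gc_tuple xs) (gc_tuple ys) =
    gc_tuple (map (\<lambda>i. \<Sum>(q, r) \<in> {(q, r). q + r = i + 1 \<and> 1 \<le> q \<and> q \<le> m + 1 \<and> 1 \<le> r \<and> r \<le> n + 1}.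
                      br (xs ! (q - 1)) (ys ! (r - 1))) [1..<m + n + 2])"
proof (intro ext)
  fix k i
  have comp: "x \<in> graded_total scale V" if "x \<in> V p" for x p
    using that unfolding graded_total_def by (blast intro: span_base)
  have zero: "(0::'v) \<in> graded_total scale V"
    unfolding graded_total_def by (rule span_zero)
  have in_total: "gc_tuple zs p j \<in> graded_total scale V"
    if "length zs = l + 1" "set zs \<subseteq> V l" for zs l p j
    using that zero by (auto simp: gc_tuple_def intro!: comp subsetD[OF that(2)] nth_mem)
  have br0l: "br 0 x = 0" if "x \<in> graded_total scale V" for x
    using br_add_left[OF zero zero that] by simp
  have br0r: "br x 0 = 0" if "x \<in> graded_total scale V" for x
    using br_add_right[OF that zero zero] by simp
  define S where "S = (\<lambda>m n. {(q, r). q + r = i + 1 \<and> 1 \<le> q \<and> q \<le> m + 1 \<and> 1 \<le> r \<and> r \<le> n + (1::nat)})"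
  let ?T = "\<lambda>a b. tuple_bracket br a b (gc_tuple xs a) (gc_tuple ys b) i"
  have other: "?T a b = 0" if "(a, b) \<noteq> (m, n)" for a b
  proof -
    have "gc_tuple xs a = (\<lambda>_. 0) \<or> gc_tuple ys b = (\<lambda>_. 0)"
      using that xs(1) ys(1) by (auto simp: gc_tuple_def fun_eq_iff)
    then show ?thesis
      unfolding tuple_bracket_def
      by (auto intro!: sum.neutral simp: br0l br0r in_total[OF xs] in_total[OF ys])
  qed
  have main: "?T m n = (\<Sum>(q, r) \<in> S m n. br (xs ! (q - 1)) (ys ! (r - 1)))"
    unfolding tuple_bracket_def S_def
    by (intro sum.cong) (auto simp: gc_tuple_def xs(1) ys(1))
  have fin: "finite {(a, b). a + b = (k::nat)}"
    by (rule finite_subset[of _ "{..k} \<times> {..k}"]) auto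
  have "gc_bracket br (gc_tuple xs) (gc_tuple ys) k i =
      (\<Sum>p \<in> {(a, b). a + b = k}. if p = (m, n) then ?T m n else 0)"
    unfolding gc_bracket_def by (intro sum.cong refl) (use other in \<open>auto split: prod.splits\<close>)
  also have "\<dots> = (if k = m + n then ?T m n else 0)"
    using fin by (auto simp: sum.delta)
  also have "\<dots> = (if k = m + n \<and> 1 \<le> i \<and> i \<le> k + 1
      then (\<Sum>(q, r) \<in> S m n. br (xs ! (q - 1)) (ys ! (r - 1))) else 0)"
  proof -
    have "S m n = {}" if "\<not> (1 \<le> i \<and> i \<le> m + n + 1)"
      using that by (auto simp: S_def)
    then show ?thesis by (auto simp: main)
  qed
  moreover have "map h [1..<m + n + 2] ! (i - 1) = h i" if "1 \<le> i" "i \<le> m + n + 1" for h :: "nat \<Rightarrow> 'v"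
  proof -
    have "i - 1 < length [1..<m + n + 2]" "1 + (i - 1) < m + n + 2" "1 + (i - 1) = i"
      using that by (simp_all del: upt_Suc)
    then show ?thesis by (simp only: nth_map nth_upt)
  qed
  ultimately show "gc_bracket br (gc_tuple xs) (gc_tuple ys) k i =
    gc_tuple (map (\<lambda>i. \<Sum>(q, r) \<in> {(q, r). q + r = i + 1 \<and> 1 \<le> q \<and> q \<le> m + 1 \<and> 1 \<le> r \<and> r \<le> n + 1}.
                      br (xs ! (q - 1)) (ys ! (r - 1))) [1..<m + n + 2]) k i"
    unfolding gc_tuple_def[of "map _ _"] S_def by (auto simp del: upt_Suc One_nat_def)
qed

lemma gc_phi_tuple:
  fixes xs :: "'v::comm_monoid_add list"
  assumes "xs \<noteq> []"
  shows "gc_phi (gc_tuple xs) = sum_list xs"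
proof -
  obtain n where n: "length xs = n + 1"
    using assms by (cases xs) auto
  have supp: "{k. gc_tuple xs k \<noteq> 0} \<subseteq> {n}"
    using n by (auto simp: gc_tuple_def fun_eq_iff)
  have "gc_phi (gc_tuple xs) = (\<Sum>k\<in>{n}. \<Sum>i = 1..k + 1. gc_tuple xs k i)"
    unfolding gc_phi_def using supp by (intro sum.mono_neutral_left) auto
  also have "\<dots> = (\<Sum>i = 1..n + 1. xs ! (i - 1))"
    using n by (auto simp: gc_tuple_def intro!: sum.cong)
  also have "\<dots> = (\<Sum>i = 0..<n + 1. xs ! i)"
    by (rule sum.reindex_bij_witness[of _ Suc "\<lambda>i. i - 1"]) auto
  finally show ?thesis
    using n by (simp add: sum_list_sum_nth)
qed

end

theory Submission imports Defs begin

text \<open>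
  The tuple \<open>(f\<^sub>1, \<dots>, f\<^bsub>n+1\<^esub>)\<close> of degree \<open>n\<close> is best read as the polynomial
  \<open>f\<^sub>1 + f\<^sub>2 t + \<dots> + f\<^bsub>n+1\<^esub> t\<^sup>n\<close> with coefficients in \<open>\<gg>\<^sup>n\<close>. The index condition
  \<open>q + r = i + 1\<close> then says that the bracket on \<open>\<gg>\<^sub>c\<close> is the \<open>t\<close>-linear extension of the
  bracket of \<open>\<gg>\<close>: on monomials it is \<open>[x t\<^sup>a, y t\<^sup>b] = [x, y] t\<^bsup>a+b\<^esup>\<close> (lemma
  \<open>gc_bracket_monomial\<close>). So \<open>\<gg>\<^sub>c\<close> is the part of the graded Lie algebra \<open>\<gg>[t]\<close> in which
  an element of degree \<open>n\<close> has at most the power \<open>t\<^sup>n\<close>, and this part is closed under the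
  bracket because \<open>a \<le> m\<close> and \<open>b \<le> n\<close> imply \<open>a + b \<le> m + n\<close>.

  All identities in question are additive in each argument, and monomials generate \<open>\<gg>\<^sub>c\<close>
  additively (\<open>gc_component_induct\<close>, \<open>gc_total_induct\<close>). On monomials, skew-symmetry and the
  Jacobi identity are those of \<open>\<gg>\<close>, as the exponents on both sides agree. The map \<open>\<phi>\<close> is
  evaluation at \<open>t = 1\<close>, which sends \<open>x t\<^sup>a\<close> to \<open>x\<close> and is therefore multiplicative.

  For the second part, the bracket of \<open>\<theta>\<^sub>1 + \<theta>\<^sub>2 t\<close> with itself is
  \<open>[\<theta>\<^sub>1, \<theta>\<^sub>1] + 2 [\<theta>\<^sub>1, \<theta>\<^sub>2] t + [\<theta>\<^sub>2, \<theta>\<^sub>2] t\<^sup>2\<close>, since the bracket is symmetric in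
  degree \<open>1\<close>. As \<open>2\<close> is invertible in characteristic \<open>0\<close>, the vanishing of the three
  coefficients is the two Maurer-Cartan equations together with compatibility.
\<close>

section \<open>The graded vector space of polynomials with bounded exponents\<close>

text \<open>
  The element \<open>x t\<^sup>a\<close> of degree \<open>n\<close>. Exponents start at \<open>0\<close> and tuple positions at \<open>1\<close>,
  hence the shift.
\<close>

definition gc_monomial :: "nat \<Rightarrow> nat \<Rightarrow> 'v \<Rightarrow> nat \<Rightarrow> nat \<Rightarrow> 'v::zero" where
  "gc_monomial n a x = (\<lambda>k i. if k = n \<and> i = a + 1 then x else 0)"

lemma gc_monomial_add:
  "gc_monomial n a (x + y) = gc_monomial n a x + gc_monomial n a (y :: 'v::monoid_add)"
  by (auto simp: gc_monomial_def fun_eq_iff)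

lemma gc_monomial_uminus: "gc_monomial n a (- x) = - gc_monomial n a (x :: 'v::ab_group_add)"
  by (auto simp: gc_monomial_def fun_eq_iff)

lemma gc_monomial_zero [simp]: "gc_monomial n a 0 = 0"
  by (auto simp: gc_monomial_def fun_eq_iff)

lemma sum_apply2: "(\<Sum>a\<in>A. f a) n i = (\<Sum>a\<in>A. f a n i)"
  for f :: "'a \<Rightarrow> nat \<Rightarrow> nat \<Rightarrow> 'v::comm_monoid_add"
  by (induction A rule: infinite_finite_induct) auto

text \<open>
  Elements of \<open>\<gg>\<^sub>c\<close> are added as vectors from here on; sums are evaluated at an entry only
  where this is asked for.
\<close>

declare plus_fun_apply [simp del] uminus_apply [simp del]

context graded_vector_space
begin

lemma component_in_total: "x \<in> V n \<Longrightarrow> x \<in> graded_total scale V"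
  unfolding graded_total_def by (blast intro: span_base)

lemma zero_in_component: "0 \<in> V n"
  using subspace_component by (rule subspace_0)

lemma gc_component_iff:
  "F \<in> gc_component V n \<longleftrightarrow>
    (\<forall>i. F n i \<in> V n) \<and> (\<forall>k i. \<not> (k = n \<and> 1 \<le> i \<and> i \<le> n + 1) \<longrightarrow> F k i = 0)"
proof
  assume "F \<in> gc_component V n"
  then obtain xs where xs: "F = gc_tuple xs" "length xs = n + 1" "set xs \<subseteq> V n"
    by (auto simp: gc_component_def)
  then show "(\<forall>i. F n i \<in> V n) \<and> (\<forall>k i. \<not> (k = n \<and> 1 \<le> i \<and> i \<le> n + 1) \<longrightarrow> F k i = 0)"
    by (auto simp: gc_tuple_def zero_in_component intro!: subsetD[OF xs(3)] nth_mem split: if_splits)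
next
  assume F: "(\<forall>i. F n i \<in> V n) \<and> (\<forall>k i. \<not> (k = n \<and> 1 \<le> i \<and> i \<le> n + 1) \<longrightarrow> F k i = 0)"
  let ?xs = "map (\<lambda>j. F n (j + 1)) [0..<n + 1]"
  have "F = gc_tuple ?xs"
  proof (intro ext)
    fix k i
    show "F k i = gc_tuple ?xs k i"
    proof (cases "k = n \<and> 1 \<le> i \<and> i \<le> n + 1")
      case True
      then have "?xs ! (i - 1) = F n i"
        by (subst nth_map) (auto simp del: upt_Suc)
      with True show ?thesis by (simp add: gc_tuple_def del: upt_Suc)
    next
      case False
      then show ?thesis using F by (auto simp: gc_tuple_def simp del: upt_Suc)
    qed
  qed
  moreover have "set ?xs \<subseteq> V n" using F by auto
  ultimately show "F \<in> gc_component V n"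
    unfolding gc_component_def by (auto intro!: exI[of _ ?xs] simp del: upt_Suc)
qed

lemma gc_monomial_in_component: "a \<le> n \<Longrightarrow> x \<in> V n \<Longrightarrow> gc_monomial n a x \<in> gc_component V n"
  by (auto simp: gc_component_iff gc_monomial_def zero_in_component)

lemma gc_scale_monomial: "gc_scale scale c (gc_monomial n a x) = gc_monomial n a (scale c x)"
  by (auto simp: gc_scale_def gc_monomial_def fun_eq_iff)

lemma vector_space_gc: "vector_space (gc_scale scale)"
  by unfold_locales (auto simp: gc_scale_def fun_eq_iff plus_fun_apply algebra_simps)

lemma graded_vector_space_gc: "graded_vector_space (gc_scale scale) (gc_component V)"
proof -
  interpret gc: vector_space "gc_scale scale" by (rule vector_space_gc)
  show ?thesis
  proof
    fix n
    show "gc.subspace (gc_component V n)"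
      using subspace_component[of n]
      by (auto simp: gc.subspace_def gc_component_iff gc_scale_def subspace_def plus_fun_apply)
  next
    fix N :: "nat set" and X n
    assume N: "finite N" "\<And>n. n \<in> N \<Longrightarrow> X n \<in> gc_component V n"
      and sum0: "(\<Sum>n\<in>N. X n) = 0" and n: "n \<in> N"
    have other: "X m k i = 0" if "m \<in> N" "k \<noteq> m" for m k i
      using N(2)[OF that(1)] that(2) by (auto simp: gc_component_iff)
    have "X n n i = 0" for i
    proof -
      have "X n n i = (\<Sum>m\<in>N. if m = n then X n n i else 0)"
        using N(1) n by simp
      also have "\<dots> = (\<Sum>m\<in>N. X m n i)"
        by (intro sum.cong) (auto simp: other)
      also have "\<dots> = 0"
        using sum0 by (simp flip: sum_apply2)
      finally show ?thesis .
    qed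
    then have "X n k i = 0" for k i
      using other[OF n, of k i] by (cases "k = n") auto
    then show "X n = 0" by (simp add: fun_eq_iff)
  qed
qed

lemma gc_component_add:
  "F \<in> gc_component V n \<Longrightarrow> G \<in> gc_component V n \<Longrightarrow> F + G \<in> gc_component V n"
proof -
  interpret gc: graded_vector_space "gc_scale scale" "gc_component V" by (rule graded_vector_space_gc)
  show "F \<in> gc_component V n \<Longrightarrow> G \<in> gc_component V n \<Longrightarrow> F + G \<in> gc_component V n"
    using gc.subspace_component by (rule gc.subspace_add)
qed

text \<open>
  A polynomial is the sum of its monomials. The zero polynomial needs no separate case, being
  the monomial with coefficient \<open>0\<close>.
\<close>

lemma gc_component_induct [consumes 1, case_names monomial add]:
  assumes "F \<in> gc_component V n"
    and monomial: "\<And>a x. a \<le> n \<Longrightarrow> x \<in> V n \<Longrightarrow> P (gc_monomial n a x)"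
    and add: "\<And>F G. \<lbrakk>F \<in> gc_component V n; G \<in> gc_component V n; P F; P G\<rbrakk> \<Longrightarrow> P (F + G)"
  shows "P F"
proof -
  have zero: "0 \<in> gc_component V n \<and> P 0"
    using monomial[of 0 0] gc_monomial_in_component[of 0 n 0] zero_in_component by simp
  have F: "F n i \<in> V n" "\<not> (k = n \<and> 1 \<le> i \<and> i \<le> n + 1) \<Longrightarrow> F k i = 0" for k i
    using assms(1) by (auto simp: gc_component_iff)
  have "(\<Sum>a\<in>A. gc_monomial n a (F n (a + 1))) \<in> gc_component V n \<and>
      P (\<Sum>a\<in>A. gc_monomial n a (F n (a + 1)))" if "finite A" "A \<subseteq> {..n}" for A
    using that
    by (induction A rule: finite_induct)
      (auto simp: zero F gc_component_add gc_monomial_in_component monomial intro!: add)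
  moreover have "F = (\<Sum>a\<le>n. gc_monomial n a (F n (a + 1)))"
  proof (intro ext)
    fix k i
    have "(\<Sum>a\<le>n. gc_monomial n a (F n (a + 1))) k i =
        (\<Sum>a\<le>n. if a = i - 1 then (if k = n \<and> 1 \<le> i then F n i else 0) else 0)"
      unfolding sum_apply2 by (intro sum.cong) (auto simp: gc_monomial_def)
    also have "\<dots> = F k i"
      using F(2)[of k i] by (auto simp: sum.delta)
    finally show "F k i = (\<Sum>a\<le>n. gc_monomial n a (F n (a + 1))) k i" by simp
  qed
  ultimately show ?thesis
    by (metis finite_atMost order_refl)
qed

lemma gc_total_induct [consumes 1, case_names monomial add]:
  assumes "F \<in> graded_total (gc_scale scale) (gc_component V)"
    and monomial: "\<And>n a x. a \<le> n \<Longrightarrow> x \<in> V n \<Longrightarrow> P (gc_monomial n a x)"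
    and add: "\<And>F G. \<lbrakk>F \<in> graded_total (gc_scale scale) (gc_component V);
      G \<in> graded_total (gc_scale scale) (gc_component V); P F; P G\<rbrakk> \<Longrightarrow> P (F + G)"
  shows "P F"
proof -
  interpret gc: graded_vector_space "gc_scale scale" "gc_component V" by (rule graded_vector_space_gc)
  have comp: "P F" if "F \<in> gc_component V n" for F n
    using that by (induction rule: gc_component_induct) (auto intro: monomial add gc.component_in_total)
  have "F \<in> graded_total (gc_scale scale) (gc_component V) \<and> P F"
    using assms(1) unfolding graded_total_def[of "gc_scale scale"]
  proof (induction rule: gc.span_induct_alt)
    case base
    show ?case using comp[OF gc.zero_in_component] gc.span_zero by blast
  next
    case (step c F G)
    then obtain n where "F \<in> gc_component V n" by blast
    then have F: "gc_scale scale c F \<in> gc_component V n"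
      using gc.subspace_component gc.subspace_scale by blast
    then show ?case
      using step(2) comp[OF F] gc.component_in_total[OF F]
      by (auto simp: graded_total_def intro: add gc.span_add)
  qed
  then show ?thesis ..
qed

lemma gc_total_add:
  "F \<in> graded_total (gc_scale scale) (gc_component V) \<Longrightarrow>
   G \<in> graded_total (gc_scale scale) (gc_component V) \<Longrightarrow>
   F + G \<in> graded_total (gc_scale scale) (gc_component V)"
  unfolding graded_total_def
  by (rule module.span_add[OF vector_space_gc[unfolded vector_space_def module_def[symmetric]]])

lemma gc_component_in_total:
  "F \<in> gc_component V n \<Longrightarrow> F \<in> graded_total (gc_scale scale) (gc_component V)"
  using graded_vector_space_gc by (rule graded_vector_space.component_in_total)

lemma gc_total_entry:
  assumes "F \<in> graded_total (gc_scale scale) (gc_component V)"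
  shows "F n i \<in> graded_total scale V"
  using assms
proof (induction rule: gc_total_induct)
  case (monomial m a x)
  then show ?case
    using component_in_total[OF zero_in_component] by (auto simp: gc_monomial_def component_in_total)
next
  case (add F G)
  then show ?case by (auto simp: graded_total_def plus_fun_apply intro: span_add)
qed

lemma gc_total_finite_support:
  assumes "F \<in> graded_total (gc_scale scale) (gc_component V)"
  shows "finite {n. F n \<noteq> 0}"
  using assms
proof (induction rule: gc_total_induct)
  case (monomial n a x)
  have "{k. gc_monomial n a x k \<noteq> 0} \<subseteq> {n}" by (auto simp: gc_monomial_def fun_eq_iff)
  then show ?case by (rule finite_subset) simp
next
  case (add F G)
  have "{n. (F + G) n \<noteq> 0} \<subseteq> {n. F n \<noteq> 0} \<union> {n. G n \<noteq> 0}" by (auto simp: fun_eq_iff plus_fun_apply)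
  then show ?case by (rule finite_subset) (simp add: add)
qed

section \<open>Evaluation at one\<close>

lemma gc_phi_monomial: "a \<le> n \<Longrightarrow> gc_phi (gc_monomial n a x) = x"
proof -
  assume a: "a \<le> n"
  have "gc_phi (gc_monomial n a x) = (\<Sum>k\<in>{n}. \<Sum>i = 1..k + 1. gc_monomial n a x k i)"
    unfolding gc_phi_def by (intro sum.mono_neutral_left) (auto simp: gc_monomial_def fun_eq_iff)
  also have "\<dots> = x"
    using a by (simp add: gc_monomial_def)
  finally show ?thesis .
qed

lemma gc_phi_add:
  assumes "F \<in> graded_total (gc_scale scale) (gc_component V)"
    and "G \<in> graded_total (gc_scale scale) (gc_component V)"
  shows "gc_phi (F + G) = gc_phi F + gc_phi G"
proof -
  let ?N = "{n. F n \<noteq> 0} \<union> {n. G n \<noteq> 0}"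
  have fin: "finite ?N" using assms by (simp add: gc_total_finite_support)
  \<comment> \<open>The three supports may differ, so all sums are extended to a common index set.\<close>
  have phi: "gc_phi H = (\<Sum>n\<in>?N. \<Sum>i = 1..n + 1. H n i)" if "{n. H n \<noteq> 0} \<subseteq> ?N" for H :: "nat \<Rightarrow> nat \<Rightarrow> 'v"
    unfolding gc_phi_def using fin that by (intro sum.mono_neutral_left) auto
  have "{n. (F + G) n \<noteq> 0} \<subseteq> ?N" by (auto simp: fun_eq_iff plus_fun_apply)
  then show ?thesis
    by (simp add: phi[of "F + G"] phi[of F] phi[of G] plus_fun_apply sum.distrib del: sum.cl_ivl_Suc)
qed

lemma gc_phi_scale:
  assumes "F \<in> graded_total (gc_scale scale) (gc_component V)"
  shows "gc_phi (gc_scale scale c F) = scale c (gc_phi F)"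
proof -
  have "scale c v = 0 \<longleftrightarrow> c = 0 \<or> v = 0" for v by (rule scale_eq_0_iff)
  then have supp: "{n. gc_scale scale c F n \<noteq> 0} = (if c = 0 then {} else {n. F n \<noteq> 0})"
    by (auto simp: gc_scale_def fun_eq_iff)
  then show ?thesis
    unfolding gc_phi_def supp by (simp add: gc_scale_def scale_sum_right del: sum.cl_ivl_Suc)
qed

lemma gc_phi_degree:
  assumes "F \<in> gc_component V n"
  shows "gc_phi F \<in> V n"
  using assms
  by (induction rule: gc_component_induct)
    (auto simp: gc_phi_monomial gc_phi_add gc_component_in_total subspace_add[OF subspace_component])

lemma gc_phi_in_total:
  assumes "F \<in> graded_total (gc_scale scale) (gc_component V)"
  shows "gc_phi F \<in> graded_total scale V"
  using assms
proof (induction rule: gc_total_induct)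
  case (monomial n a x)
  then show ?case by (simp add: gc_phi_monomial component_in_total)
next
  case (add F G)
  then show ?case by (simp add: gc_phi_add) (simp add: graded_total_def span_add)
qed

end

section \<open>The bracket on monomials and its additive extension\<close>

context graded_Lie_algebra
begin

lemma br_zero_left: "x \<in> graded_total scale V \<Longrightarrow> br 0 x = 0"
  using br_add_left[OF component_in_total[OF zero_in_component] component_in_total[OF zero_in_component], of x]
  by simp

lemma br_zero_right: "x \<in> graded_total scale V \<Longrightarrow> br x 0 = 0"
  using br_add_right[OF _ component_in_total[OF zero_in_component] component_in_total[OF zero_in_component], of x]
  by simp

lemma gc_bracket_monomial:
  assumes "a \<le> m" "x \<in> V m" "b \<le> n" "y \<in> V n"
  shows "gc_bracket br (gc_monomial m a x) (gc_monomial n b y) = gc_monomial (m + n) (a + b) (br x y)"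
proof (intro ext)
  fix k i
  let ?S = "\<lambda>m n. {(q, r). q + r = i + 1 \<and> 1 \<le> q \<and> q \<le> m + 1 \<and> 1 \<le> r \<and> r \<le> n + (1::nat)}"
  note zero = br_zero_left[OF component_in_total] br_zero_right[OF component_in_total]
  have fin: "finite {(m, n). m + n = (k::nat)}" "finite (?S m n)" for m n
    by (rule finite_subset[of _ "{..k} \<times> {..k}"], auto)
      (rule finite_subset[of _ "{..i+1} \<times> {..i+1}"], auto)
  have entry: "br (gc_monomial m a x m' q) (gc_monomial n b y n' r) =
      (if (m', n') = (m, n) \<and> (q, r) = (a + 1, b + 1) then br x y else 0)" for m' n' q r
    using zero[OF assms(2)] zero[OF assms(4)] zero[OF zero_in_component]
    by (auto simp: gc_monomial_def)
  have inner: "tuple_bracket br m' n' (gc_monomial m a x m') (gc_monomial n b y n') i =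
      (if (m', n') = (m, n) then if i = a + b + 1 then br x y else 0 else 0)" for m' n'
  proof -
    have "tuple_bracket br m' n' (gc_monomial m a x m') (gc_monomial n b y n') i =
      (\<Sum>p\<in>?S m' n'. if p = (a + 1, b + 1) then if (m', n') = (m, n) then br x y else 0 else 0)"
      unfolding tuple_bracket_def entry by (intro sum.cong) (auto split: if_splits)
    also have "\<dots> = (if (m', n') = (m, n) then if i = a + b + 1 then br x y else 0 else 0)"
      using assms fin(2)[of m' n'] by (auto simp: sum.delta)
    finally show ?thesis .
  qed
  have "gc_bracket br (gc_monomial m a x) (gc_monomial n b y) k i =
     (\<Sum>p\<in>{(m, n). m + n = k}. if p = (m, n) then if i = a + b + 1 then br x y else 0 else 0)"
    unfolding gc_bracket_def inner by (intro sum.cong) (auto split: if_splits)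
  also have "\<dots> = gc_monomial (m + n) (a + b) (br x y) k i"
    using fin(1) by (auto simp: sum.delta gc_monomial_def)
  finally show "gc_bracket br (gc_monomial m a x) (gc_monomial n b y) k i =
    gc_monomial (m + n) (a + b) (br x y) k i" .
qed

abbreviation "gc_total \<equiv> graded_total (gc_scale scale) (gc_component V)"

lemma gc_bracket_add_left:
  assumes "F \<in> gc_total" "G \<in> gc_total" "H \<in> gc_total"
  shows "gc_bracket br (F + G) H = gc_bracket br F H + gc_bracket br G H"
  using assms
  by (auto simp: fun_eq_iff gc_bracket_def tuple_bracket_def gc_total_entry br_add_left
      split_def sum.distrib plus_fun_apply)

lemma gc_bracket_add_right:
  assumes "F \<in> gc_total" "G \<in> gc_total" "H \<in> gc_total"
  shows "gc_bracket br F (G + H) = gc_bracket br F G + gc_bracket br F H"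
  using assms
  by (auto simp: fun_eq_iff gc_bracket_def tuple_bracket_def gc_total_entry br_add_right
      split_def sum.distrib plus_fun_apply)

lemma gc_bracket_scale_left:
  assumes "F \<in> gc_total" "G \<in> gc_total"
  shows "gc_bracket br (gc_scale scale c F) G = gc_scale scale c (gc_bracket br F G)"
  using assms
  by (auto simp: fun_eq_iff gc_bracket_def tuple_bracket_def gc_total_entry br_scale_left
      split_def scale_sum_right gc_scale_def)

lemma gc_bracket_scale_right:
  assumes "F \<in> gc_total" "G \<in> gc_total"
  shows "gc_bracket br F (gc_scale scale c G) = gc_scale scale c (gc_bracket br F G)"
  using assms
  by (auto simp: fun_eq_iff gc_bracket_def tuple_bracket_def gc_total_entry br_scale_right
      split_def scale_sum_right gc_scale_def)

lemma gc_bracket_degree: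
  assumes "F \<in> gc_component V m" "G \<in> gc_component V n"
  shows "gc_bracket br F G \<in> gc_component V (m + n)"
  using assms(1)
proof (induction rule: gc_component_induct)
  case F: (monomial a x)
  show ?case
    using assms(2)
  proof (induction rule: gc_component_induct)
    case (monomial b y)
    then show ?case
      using F by (simp add: gc_bracket_monomial gc_monomial_in_component br_degree)
  next
    case (add G H)
    then show ?case
      using F by (simp add: gc_bracket_add_right gc_component_add gc_component_in_total[of _ n]
          gc_component_in_total[OF gc_monomial_in_component])
  qed
next
  case (add F H)
  then show ?case
    using assms(2) by (simp add: gc_bracket_add_left gc_component_add gc_component_in_total[of _ n]
      gc_component_in_total[of _ m])
qed

lemma gc_scale_add: "gc_scale scale c (F + G) = gc_scale scale c F + gc_scale scale c G"
  by (simp add: gc_scale_def fun_eq_iff plus_fun_apply scale_right_distrib)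

text \<open>
  Both sides are additive in each argument, and on monomials the claim is skew-symmetry in
  \<open>\<gg>\<close> multiplied by \<open>t\<^bsup>a+b\<^esup> = t\<^bsup>b+a\<^esup>\<close>.
\<close>

lemma gc_bracket_skew:
  assumes "F \<in> gc_component V m" "G \<in> gc_component V n"
  shows "gc_bracket br F G = - gc_scale scale ((- 1) ^ (m * n)) (gc_bracket br G F)"
  using assms(1)
proof (induction rule: gc_component_induct)
  case F: (monomial a x)
  have x: "gc_monomial m a x \<in> gc_total"
    using F by (blast intro: gc_component_in_total gc_monomial_in_component)
  show ?case
    using assms(2)
  proof (induction rule: gc_component_induct)
    case (monomial b y)
    then show ?case
      using F by (simp add: gc_bracket_monomial gc_scale_monomial br_skew[OF F(2) monomial(2)]
          gc_monomial_uminus add.commute)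
  next
    case (add G H)
    have "G \<in> gc_total" "H \<in> gc_total"
      using add by (blast intro: gc_component_in_total)+
    then show ?case
      using add x by (simp add: gc_bracket_add_right gc_bracket_add_left gc_scale_add)
  qed
next
  case (add F H)
  have "F \<in> gc_total" "H \<in> gc_total" "G \<in> gc_total"
    using add assms(2) by (blast intro: gc_component_in_total)+
  then show ?case
    using add by (simp add: gc_bracket_add_right gc_bracket_add_left gc_scale_add)
qed

text \<open>
  Again a trilinear identity, which on monomials is the Jacobi identity of \<open>\<gg>\<close> multiplied
  by \<open>t\<^bsup>a+b+c\<^esup>\<close>.
\<close>

lemma gc_bracket_Jacobi:
  assumes "F \<in> gc_component V m" "G \<in> gc_component V n" "H \<in> gc_component V p"
  shows "gc_bracket br F (gc_bracket br G H) = gc_bracket br (gc_bracket br F G) H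
    + gc_scale scale ((- 1) ^ (m * n)) (gc_bracket br G (gc_bracket br F H))"
proof -
  note additive = gc_bracket_add_left gc_bracket_add_right gc_scale_add
  have tot: "F \<in> gc_total" if "F \<in> gc_component V l" for F l
    using that by (rule gc_component_in_total)
  have tot_br: "gc_bracket br F G \<in> gc_total" if "F \<in> gc_component V l" "G \<in> gc_component V l'" for F G l l'
    using gc_bracket_degree[OF that] by (rule tot)
  show ?thesis
    using assms(1)
  proof (induction rule: gc_component_induct)
    case F: (monomial a x)
    let ?x = "gc_monomial m a x"
    have Fx: "?x \<in> gc_component V m" using F by (rule gc_monomial_in_component)
    show ?case
      using assms(2)
    proof (induction rule: gc_component_induct)
      case G: (monomial b y)
      let ?y = "gc_monomial n b y"
      have Gy: "?y \<in> gc_component V n" using G by (rule gc_monomial_in_component)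
      show ?case
        using assms(3)
      proof (induction rule: gc_component_induct)
        case (monomial c z)
        then show ?case
          using F G
          by (simp add: gc_bracket_monomial br_degree gc_scale_monomial br_Jacobi[OF F(2) G(2)]
              ac_simps flip: gc_monomial_add)
      next
        case (add H H')
        note H = tot[OF add(1)] tot[OF add(2)] tot_br[OF Fx add(1)] tot_br[OF Fx add(2)]
          tot_br[OF Gy add(1)] tot_br[OF Gy add(2)] tot_br[OF Fx Gy]
        show ?case
          using add(3,4) H tot[OF Fx] tot[OF Gy] by (simp add: additive ac_simps)
      qed
    next
      case (add G G')
      note G = tot[OF add(1)] tot[OF add(2)] tot_br[OF Fx add(1)] tot_br[OF Fx add(2)]
        tot_br[OF add(1) assms(3)] tot_br[OF add(2) assms(3)] tot_br[OF Fx assms(3)]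
      show ?case
        using add(3,4) G tot[OF Fx] tot[OF assms(3)] by (simp add: additive ac_simps)
    qed
  next
    case (add F F')
    note F = tot[OF add(1)] tot[OF add(2)] tot_br[OF add(1) assms(2)] tot_br[OF add(2) assms(2)]
      tot_br[OF add(1) assms(3)] tot_br[OF add(2) assms(3)] tot_br[OF assms(2) assms(3)]
    show ?case
      using add(3,4) F tot[OF assms(2)] tot[OF assms(3)] by (simp add: additive ac_simps)
  qed
qed

theorem graded_Lie_algebra_gc:
  "graded_Lie_algebra (gc_scale scale) (gc_component V) (gc_bracket br)"
  using graded_vector_space_gc gc_bracket_add_left gc_bracket_add_right gc_bracket_scale_left
    gc_bracket_scale_right gc_bracket_degree gc_bracket_skew gc_bracket_Jacobi
  by (intro graded_Lie_algebra.intro graded_Lie_algebra_axioms.intro)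

text \<open>
  Evaluation at \<open>t = 1\<close> respects the bracket because it forgets the exponent: it sends
  \<open>[x t\<^sup>a, y t\<^sup>b] = [x, y] t\<^bsup>a+b\<^esup>\<close> to \<open>[x, y]\<close>. The bracket of two arbitrary elements is shown to lie in
  \<open>\<gg>\<^sub>c\<close> along the way, as additivity of \<open>\<phi>\<close> is known only there.
\<close>

lemma gc_phi_bracket:
  assumes "F \<in> gc_total" "G \<in> gc_total"
  shows "gc_bracket br F G \<in> gc_total \<and> gc_phi (gc_bracket br F G) = br (gc_phi F) (gc_phi G)"
  using assms(1)
proof (induction rule: gc_total_induct)
  case F: (monomial m a x)
  have x: "gc_monomial m a x \<in> gc_total"
    using F by (blast intro: gc_component_in_total gc_monomial_in_component)
  show ?case
    using assms(2)
  proof (induction rule: gc_total_induct)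
    case (monomial n b y)
    then have "gc_monomial (m + n) (a + b) (br x y) \<in> gc_component V (m + n)"
      using F by (simp add: gc_monomial_in_component br_degree)
    then show ?case
      using F monomial by (simp add: gc_bracket_monomial gc_phi_monomial gc_component_in_total)
  next
    case (add G H)
    then show ?case
      using x by (simp add: gc_bracket_add_right gc_phi_add gc_total_add br_add_right gc_phi_in_total)
  qed
next
  case (add F H)
  then show ?case
    using assms(2) by (simp add: gc_bracket_add_left gc_phi_add gc_total_add br_add_left gc_phi_in_total)
qed

theorem gc_phi_morphism:
  "graded_Lie_morphism (gc_scale scale) (gc_component V) (gc_bracket br) scale V br gc_phi"
  using graded_Lie_algebra_gc graded_Lie_algebra_axioms gc_phi_add gc_phi_scale gc_phi_degree
    gc_phi_bracket
  by (intro graded_Lie_morphism.intro graded_Lie_morphism_axioms.intro) blast+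

section \<open>Maurer-Cartan elements\<close>

lemma Maurer_Cartan_gc_iff:
  assumes "\<theta>\<^sub>1 \<in> V 1" "\<theta>\<^sub>2 \<in> V 1"
  shows "compatible_MC_pair V br \<theta>\<^sub>1 \<theta>\<^sub>2 \<longleftrightarrow>
    Maurer_Cartan (gc_component V) (gc_bracket br) (gc_tuple [\<theta>\<^sub>1, \<theta>\<^sub>2])"
proof -
  define T\<^sub>1 T\<^sub>2 where "T\<^sub>1 = gc_monomial 1 0 \<theta>\<^sub>1" and "T\<^sub>2 = gc_monomial 1 1 \<theta>\<^sub>2"
  have tuple: "gc_tuple [\<theta>\<^sub>1, \<theta>\<^sub>2] = T\<^sub>1 + T\<^sub>2"
    by (auto simp: T\<^sub>1_def T\<^sub>2_def gc_tuple_def gc_monomial_def fun_eq_iff plus_fun_apply nth_Cons')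
  have comp: "T\<^sub>1 \<in> gc_component V 1" "T\<^sub>2 \<in> gc_component V 1"
    using assms by (auto simp: T\<^sub>1_def T\<^sub>2_def intro!: gc_monomial_in_component)
  then have tot: "T\<^sub>1 \<in> gc_total" "T\<^sub>2 \<in> gc_total" "T\<^sub>1 + T\<^sub>2 \<in> gc_total"
    by (auto intro: gc_component_in_total gc_total_add)
  have sym: "br \<theta>\<^sub>2 \<theta>\<^sub>1 = br \<theta>\<^sub>1 \<theta>\<^sub>2"
    using br_skew[OF assms(2,1)] by simp
  have "gc_bracket br (T\<^sub>1 + T\<^sub>2) (T\<^sub>1 + T\<^sub>2) =
      gc_monomial 2 0 (br \<theta>\<^sub>1 \<theta>\<^sub>1) + gc_monomial 2 1 (br \<theta>\<^sub>1 \<theta>\<^sub>2 + br \<theta>\<^sub>1 \<theta>\<^sub>2)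
      + gc_monomial 2 2 (br \<theta>\<^sub>2 \<theta>\<^sub>2)" (is "_ = ?B")
    using assms tot
    by (simp add: gc_bracket_add_left gc_bracket_add_right)
       (simp add: T\<^sub>1_def T\<^sub>2_def gc_bracket_monomial[of _ 1 _ _ 1, simplified] sym gc_monomial_add
         numeral_2_eq_2)
  moreover have "?B = 0 \<longleftrightarrow> br \<theta>\<^sub>1 \<theta>\<^sub>1 = 0 \<and> br \<theta>\<^sub>1 \<theta>\<^sub>2 + br \<theta>\<^sub>1 \<theta>\<^sub>2 = 0 \<and> br \<theta>\<^sub>2 \<theta>\<^sub>2 = 0"
  proof
    assume B: "?B = 0"
    have "?B 2 1 = 0" "?B 2 2 = 0" "?B 2 3 = 0"
      unfolding B by simp_all
    then show "br \<theta>\<^sub>1 \<theta>\<^sub>1 = 0 \<and> br \<theta>\<^sub>1 \<theta>\<^sub>2 + br \<theta>\<^sub>1 \<theta>\<^sub>2 = 0 \<and> br \<theta>\<^sub>2 \<theta>\<^sub>2 = 0"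
      by (simp add: gc_monomial_def plus_fun_apply)
  qed simp
  moreover have "x + x = 0 \<longleftrightarrow> x = 0" for x :: 'v
  proof -
    have "x + x = scale 2 x"
      using scale_left_distrib[of 1 1 x] by simp
    then show ?thesis by simp
  qed
  ultimately show ?thesis
    using assms comp
    by (auto simp: compatible_MC_pair_def Maurer_Cartan_def tuple gc_component_add)
qed

end

theorem proposition2p9:
  fixes scale :: "'k::field_char_0 \<Rightarrow> 'v::ab_group_add \<Rightarrow> 'v"
    and V :: "nat \<Rightarrow> 'v set"
    and br :: "'v \<Rightarrow> 'v \<Rightarrow> 'v"
  assumes "graded_Lie_algebra scale V br"
  shows "graded_Lie_algebra (gc_scale scale) (gc_component V) (gc_bracket br)
    \<and> graded_Lie_morphism (gc_scale scale) (gc_component V) (gc_bracket br) scale V br gc_phi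
    \<and> (\<forall>\<theta>\<^sub>1 \<in> V 1. \<forall>\<theta>\<^sub>2 \<in> V 1.
         compatible_MC_pair V br \<theta>\<^sub>1 \<theta>\<^sub>2 \<longleftrightarrow>
         Maurer_Cartan (gc_component V) (gc_bracket br) (gc_tuple [\<theta>\<^sub>1, \<theta>\<^sub>2]))"
proof -
  interpret graded_Lie_algebra scale V br by fact
  show ?thesis
    using graded_Lie_algebra_gc gc_phi_morphism Maurer_Cartan_gc_iff by blast
qed

end
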